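(* Let $s$ and $n$ be positive integers. For each positive integer $m$ let $\lambda_m = (m, m-1, \ldots, 1)$. Then \[c_{s*\lambda_{2n-1},\, s*(n, n)}^{s*\lambda_{2n}} = \binom{2n}{sn}_s - \binom{2n}{sn+1}_s,\] where $c^{\lambda}_{\mu,\nu}$ denotes the Littlewood-Richardson coefficient, $s*\lambda$ denotes the partition obtained by multiplying every part of $\lambda$ by $s$, and $\binom{n}{k}_s$ denotes the $s$-binomial coefficient.
   Context: $s$-binomial coefficients: for positive integers $n, s$ and an integer $k$ with $0\le k\le sn$, $\binom{n}{k}_s$ is the coefficient of $x^k$ in $(1+x+x^2+\cdots+x^s)^n$. Stretching: for a partition $\lambda = (\lambda_1,\lambda_2,\ldots)$, $s*\lambda = (s\lambda_1, s\lambda_2, \ldots)$; e.g. $3*(3,2,1) = (9,6,3)$. Littlewood-Richardson coefficients: $c^{\lambda}_{\mu,\nu}$ is the multiplicity of $V^\lambda$ in $V^\mu\otimes V^\nu$, where $V^\mu, V^\nu, V^\lambda$ are irreducible polynomial representations of $GL(N)$ ($N$ at least the number of parts of each partition involved). Equivalently (Littlewood-Richardson rule), $c^{\lambda}_{\mu,\nu}$ is the number of semistandard fillings (weakly increasing along rows, strictly increasing down columns) of the skew shape $\lambda/\mu$ with content $\nu$ (exactly $\nu_i$ entries equal to $i$ for each $i$) such that the word obtained by reading the rows from top to bottom, each row from right to left, is a ballot word: in every initial segment, the number of $a$'s is at least the number of $b$'s whenever $a<b$. *)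

theory Defs
  imports "HOL-Computational_Algebra.Polynomial"
begin

text \<open>
  A partition is represented by a weakly decreasing list of natural numbers, continued by
  zeros. Indices are 0-based: the part usually written with index i + 1 is \<open>part lam i\<close>.
\<close>

definition part :: "nat list \<Rightarrow> nat \<Rightarrow> nat" where
  "part lam i = (if i < length lam then lam ! i else 0)"

definition stretch :: "nat \<Rightarrow> nat list \<Rightarrow> nat list" where
  "stretch s lam = map (\<lambda>p. s * p) lam"

definition staircase :: "nat \<Rightarrow> nat list" where
  "staircase m = rev [1..<m + 1]"

definition s_binomial :: "nat \<Rightarrow> nat \<Rightarrow> nat \<Rightarrow> int" where
  "s_binomial s n k = coeff ((\<Sum>i\<le>s. monom 1 i) ^ n) k"

text \<open>A cell is a pair (row, column), both counted from 0.\<close>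

definition skew_shape :: "nat list \<Rightarrow> nat list \<Rightarrow> (nat \<times> nat) set" where
  "skew_shape lam \<mu> = {(i, j). part \<mu> i \<le> j \<and> j < part lam i}"

definition semistandard :: "(nat \<times> nat) set \<Rightarrow> (nat \<times> nat \<Rightarrow> nat) \<Rightarrow> bool" where
  "semistandard S T \<longleftrightarrow>
     (\<forall>c \<in> S. 1 \<le> T c) \<and>
     (\<forall>i j j'. (i, j) \<in> S \<and> (i, j') \<in> S \<and> j < j' \<longrightarrow> T (i, j) \<le> T (i, j')) \<and>
     (\<forall>i i' j. (i, j) \<in> S \<and> (i', j) \<in> S \<and> i < i' \<longrightarrow> T (i, j) < T (i', j))"

definition has_content :: "(nat \<times> nat) set \<Rightarrow> (nat \<times> nat \<Rightarrow> nat) \<Rightarrow> nat list \<Rightarrow> bool" where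
  "has_content S T \<nu> \<longleftrightarrow> (\<forall>i. card {c \<in> S. T c = i + 1} = part \<nu> i)"

definition reading_word :: "nat list \<Rightarrow> nat list \<Rightarrow> (nat \<times> nat \<Rightarrow> nat) \<Rightarrow> nat list" where
  "reading_word lam \<mu> T =
     concat (map (\<lambda>i. map (\<lambda>j. T (i, j)) (rev [part \<mu> i..<part lam i])) [0..<length lam])"

definition ballot :: "nat list \<Rightarrow> bool" where
  "ballot w \<longleftrightarrow>
     (\<forall>p \<le> length w. \<forall>a b. 1 \<le> a \<and> a < b \<longrightarrow>
        count_list (take p w) b \<le> count_list (take p w) a)"

text \<open>
  Fillings are total functions, so they are required to vanish outside the shape in order to
  be counted only once. If \<open>\<mu>\<close> is not contained in \<open>lam\<close> there is no skew shape, and the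
  coefficient is 0. In \<open>LR_coeff lam \<mu> \<nu>\<close> the first argument is the upper (outer) partition of
  the Littlewood-Richardson coefficient, \<open>\<mu>\<close> the inner one, and \<open>\<nu>\<close> the content.
\<close>

definition LR_tableaux ::
    "nat list \<Rightarrow> nat list \<Rightarrow> nat list \<Rightarrow> (nat \<times> nat \<Rightarrow> nat) set" where
  "LR_tableaux lam \<mu> \<nu> =
     {T. (\<forall>i. part \<mu> i \<le> part lam i) \<and>
         (\<forall>c. c \<notin> skew_shape lam \<mu> \<longrightarrow> T c = 0) \<and>
         semistandard (skew_shape lam \<mu>) T \<and>
         has_content (skew_shape lam \<mu>) T \<nu> \<and>
         ballot (reading_word lam \<mu> T)}"

definition LR_coeff :: "nat list \<Rightarrow> nat list \<Rightarrow> nat list \<Rightarrow> nat" where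
  "LR_coeff lam \<mu> \<nu> = card (LR_tableaux lam \<mu> \<nu>)"

text \<open>The set counted by \<^const>\<open>LR_coeff\<close> is finite, so its \<^const>\<open>card\<close> is the true count.\<close>

lemma finite_skew_shape: "finite (skew_shape lam \<mu>)"
proof (rule finite_subset)
  show "skew_shape lam \<mu> \<subseteq> (SIGMA i:{..<length lam}. {..<part lam i})"
    by (auto simp: skew_shape_def part_def split: if_splits)
qed auto

lemma finite_LR_tableaux: "finite (LR_tableaux lam \<mu> \<nu>)"
proof (rule finite_subset)
  let ?S = "skew_shape lam \<mu>"
  show "LR_tableaux lam \<mu> \<nu> \<subseteq>
      {T. \<forall>c. (c \<in> ?S \<longrightarrow> T c \<in> {..length \<nu>}) \<and> (c \<notin> ?S \<longrightarrow> T c = 0)}"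
  proof clarify
    fix T and i j :: nat
    assume T: "T \<in> LR_tableaux lam \<mu> \<nu>"
    have "T (i, j) \<le> length \<nu>" if c: "(i, j) \<in> ?S"
    proof (rule ccontr)
      assume "\<not> T (i, j) \<le> length \<nu>"
      then obtain k where k: "T (i, j) = k + 1" "length \<nu> \<le> k"
        by (cases "T (i, j)") auto
      have "card {c \<in> ?S. T c = k + 1} = part \<nu> k"
        using T by (simp add: LR_tableaux_def has_content_def)
      then have "{c \<in> ?S. T c = k + 1} = {}"
        using k(2) finite_skew_shape[of lam \<mu>] by (simp add: part_def)
      then show False using c k(1) by blast
    qed
    then show "((i, j) \<in> ?S \<longrightarrow> T (i, j) \<in> {..length \<nu>}) \<and> ((i, j) \<notin> ?S \<longrightarrow> T (i, j) = 0)"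
      using T by (simp add: LR_tableaux_def)
  qed
  show "finite {T. \<forall>c. (c \<in> ?S \<longrightarrow> T c \<in> {..length \<nu>}) \<and> (c \<notin> ?S \<longrightarrow> T c = 0)}"
    by (rule finite_set_of_finite_funs) (auto simp: finite_skew_shape)
qed

end

theory Submission
  imports Defs
begin

text \<open>
  The rows of the skew shape occupy pairwise disjoint sets of columns, so the column condition
  is vacuous, and a tableau with entries 1 and 2 amounts to the list of the numbers \<open>k\<close> of 2s
  in its rows. A row is read as \<open>k\<close> letters 2 followed by \<open>s - k\<close> letters 1, so the ballot
  condition says that \<open>k\<close> never exceeds the current excess \<open>w\<close> of 1s over 2s, which then
  becomes \<open>w + s - 2k\<close>: this is the Clebsch-Gordan rule for tensoring with the
  \<open>s\<close>-th symmetric power. Conditioning on the last row, the number of admissible lists of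
  length \<open>m\<close> and sum \<open>t\<close> is a difference of consecutive \<open>s\<close>-binomial coefficients when
  \<open>2t \<le> sm\<close>; the terms excluded by the ballot condition telescope to a difference that
  vanishes by the symmetry of these coefficients.
\<close>

section \<open>Binomial coefficients with integer lower index\<close>

text \<open>The coefficient of \<open>x^t\<close> in \<open>(1 + x + ... + x^s)^m\<close>, with one
  factor split off per step. The integer index makes the value at negative \<open>t\<close> zero and
  keeps index shifts free of truncation.\<close>

fun sbinom :: "nat \<Rightarrow> nat \<Rightarrow> int \<Rightarrow> int" where
  "sbinom s 0 t = (if t = 0 then 1 else 0)"
| "sbinom s (Suc m) t = (\<Sum>k\<le>s. sbinom s m (t - int k))"

lemma sbinom_neg: "t < 0 \<Longrightarrow> sbinom s m t = 0"
  by (induction m arbitrary: t) auto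

text \<open>Replacing \<open>k\<close> by \<open>s - k\<close> in each factor reverses the
  coefficients.\<close>

lemma sbinom_symmetric: "sbinom s m (int (s * m) - t) = sbinom s m t"
proof (induction m arbitrary: t)
  case (Suc m)
  have "sbinom s (Suc m) (int (s * Suc m) - t) =
      (\<Sum>k\<le>s. sbinom s m (int (s * Suc m) - t - int (s - k)))"
    unfolding sbinom.simps
    by (rule sum.reindex_bij_witness[of _ "\<lambda>k. s - k" "\<lambda>k. s - k"]) auto
  also have "\<dots> = (\<Sum>k\<le>s. sbinom s m (int (s * m) - (t - int k)))"
    by (intro sum.cong refl arg_cong[where f = "sbinom s m"]) (simp add: of_nat_diff algebra_simps)
  finally show ?case by (simp only: Suc.IH sbinom.simps)
qed auto

lemma s_binomial_eq_sbinom: "s_binomial s m t = sbinom s m (int t)"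
proof (induction m arbitrary: t)
  case (Suc m)
  have "s_binomial s (Suc m) t =
      (\<Sum>k\<le>s. coeff (monom 1 k * (\<Sum>i\<le>s. monom 1 i) ^ m) t)"
    by (simp add: s_binomial_def sum_distrib_right coeff_sum)
  also have "\<dots> = (\<Sum>k\<le>s. sbinom s m (int t - int k))"
  proof (intro sum.cong refl)
    fix k
    show "coeff (monom 1 k * (\<Sum>i\<le>s. monom 1 i) ^ m) t = sbinom s m (int t - int k)"
    \<comment> \<open>For \<open>k > t\<close> both sides vanish: the left polynomial is divisible
      by \<open>x^k\<close>, and the right index is negative.\<close>
    proof (cases "k \<le> t")
      case True
      then have "coeff (monom 1 k * (\<Sum>i\<le>s. monom 1 i) ^ m) t = s_binomial s m (t - k)"
        by (simp add: coeff_monom_mult s_binomial_def)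
      then show ?thesis using True by (simp add: Suc.IH of_nat_diff)
    qed (simp add: coeff_monom_mult sbinom_neg)
  qed
  finally show ?case by simp
qed (simp add: s_binomial_def)

section \<open>Ballot sequences\<close>

text \<open>The first \<open>i\<close> rows hold \<open>s * i\<close> letters, so the excess of 1s
  over 2s is \<open>s * i - 2 * sum_list (take i ks)\<close>; the bound by this excess is written
  additively to avoid truncated subtraction.\<close>

definition ballot_steps :: "nat \<Rightarrow> nat list \<Rightarrow> bool" where
  "ballot_steps s ks \<longleftrightarrow> (\<forall>i<length ks. 2 * sum_list (take i ks) + ks ! i \<le> s * i)"

definition ballot_seqs :: "nat \<Rightarrow> nat \<Rightarrow> nat \<Rightarrow> nat list set" where
  "ballot_seqs s m t =
     {ks. length ks = m \<and> set ks \<subseteq> {..s} \<and> ballot_steps s ks \<and> sum_list ks = t}"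

lemma ballot_steps_Nil: "ballot_steps s []"
  by (simp add: ballot_steps_def)

lemma ballot_steps_snoc:
  "ballot_steps s (ks @ [k]) \<longleftrightarrow>
     ballot_steps s ks \<and> 2 * sum_list ks + k \<le> s * length ks"
  by (auto simp: ballot_steps_def nth_append less_Suc_eq)

lemma finite_ballot_seqs: "finite (ballot_seqs s m t)"
  by (rule finite_subset[OF _ finite_lists_length_eq[of "{..s}" m]])
     (auto simp: ballot_seqs_def)

text \<open>With last entry \<open>k\<close>, the earlier entries sum to \<open>t - k\<close>, and
  the last ballot inequality \<open>2 * (t - k) + k \<le> s * m\<close> becomes
  \<open>2 * t \<le> s * m + k\<close>.\<close>

lemma ballot_seqs_Suc:
  "ballot_seqs s (Suc m) t =
     (\<Union>k\<in>{k. k \<le> s \<and> k \<le> t \<and> 2 * t \<le> s * m + k}. (\<lambda>ks. ks @ [k]) ` ballot_seqs s m (t - k))"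
  (is "?L = ?R")
proof (intro equalityI subsetI)
  fix xs assume xs: "xs \<in> ?L"
  then obtain ks k where "xs = ks @ [k]"
    by (cases xs rule: rev_cases) (auto simp: ballot_seqs_def)
  with xs show "xs \<in> ?R"
    by (auto simp: ballot_seqs_def ballot_steps_snoc)
qed (auto simp: ballot_seqs_def ballot_steps_snoc)

lemma card_ballot_seqs_Suc:
  "card (ballot_seqs s (Suc m) t) =
     (\<Sum>k | k \<le> s \<and> k \<le> t \<and> 2 * t \<le> s * m + k. card (ballot_seqs s m (t - k)))"
  unfolding ballot_seqs_Suc
  by (subst card_UN_disjoint) (auto simp: finite_ballot_seqs card_image inj_on_def)

lemma card_ballot_seqs:
  assumes "2 * t \<le> s * m"
  shows "int (card (ballot_seqs s m t)) = sbinom s m (int t) - sbinom s m (int t - 1)"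
  using assms
proof (induction m arbitrary: t)
  case 0
  have "ballot_seqs s 0 0 = {[]}"
    by (auto simp: ballot_seqs_def ballot_steps_Nil)
  then show ?case using 0 by simp
next
  case (Suc m)
  define g where "g k = sbinom s m (int t - int k) - sbinom s m (int t - int k - 1)" for k
  let ?K = "{k. k \<le> s \<and> k \<le> t \<and> 2 * t \<le> s * m + k}"
  \<comment> \<open>The least \<open>k\<close> allowed by the last ballot inequality; truncation
    gives 0 when that inequality holds for every \<open>k\<close>.\<close>
  define d where "d = 2 * t - s * m"
  have d: "d \<le> s" using Suc.prems by (simp add: d_def)
  \<comment> \<open>The induction hypothesis applies because \<open>2 * t \<le> s * m + k\<close>
    implies \<open>2 * (t - k) \<le> s * m\<close>.\<close>
  have "int (card (ballot_seqs s (Suc m) t)) = (\<Sum>k\<in>?K. g k)"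
    unfolding card_ballot_seqs_Suc of_nat_sum
    by (intro sum.cong refl) (use Suc.IH in \<open>auto simp: g_def of_nat_diff\<close>)
  also have "\<dots> = sum g {d..s}"
  proof (rule sum.mono_neutral_left)
    have "g k = 0" if "\<not> k \<le> t" for k
      using that by (simp add: g_def sbinom_neg)
    moreover have "2 * t \<le> s * m + k" if "d \<le> k" for k
      using that by (simp add: d_def)
    ultimately show "\<forall>k\<in>{d..s} - ?K. g k = 0"
      by auto
  qed (auto simp: d_def)
  also have "\<dots> = sum g {..s}"
  proof -
    \<comment> \<open>Each \<open>g k\<close> is a difference of values at consecutive
      \<open>k\<close>, so only the ends remain. If \<open>d > 0\<close>, these have indices
      \<open>t\<close> and \<open>s * m - t\<close>, which symmetry identifies.\<close>
    have "sum g {..<d} = sbinom s m (int t) - sbinom s m (int t - int d)"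
      using sum_lessThan_telescope'[of "\<lambda>k. sbinom s m (int t - int k)" d]
      by (simp add: g_def algebra_simps)
    also have "\<dots> = 0"
    proof (cases "d = 0")
      case False
      then have "int t - int d = int (s * m) - int t"
        by (simp add: d_def of_nat_diff)
      then show ?thesis by (simp only: sbinom_symmetric diff_self)
    qed simp
    finally have "sum g {..<d} = 0" .
    moreover have "{..s} = {..<d} \<union> {d..s}" using d by auto
    moreover have "sum g ({..<d} \<union> {d..s}) = sum g {..<d} + sum g {d..s}"
      by (rule sum.union_disjoint) auto
    ultimately show ?thesis by simp
  qed
  also have "\<dots> = sbinom s (Suc m) (int t) - sbinom s (Suc m) (int t - 1)"
    by (simp add: g_def sum_subtractf algebra_simps)
  finally show ?case .
qed

section \<open>Ballot words in two letters\<close>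

lemma count_list_replicate: "count_list (replicate k x) y = (if x = y then k else 0)"
  by (induction k) auto

lemma ballot_snoc:
  "ballot (u @ [x]) \<longleftrightarrow>
     ballot u \<and> (\<forall>a b. 1 \<le> a \<and> a < b \<longrightarrow> count_list (u @ [x]) b \<le> count_list (u @ [x]) a)"
  by (auto simp: ballot_def le_Suc_eq)

lemma ballot_count_le: "ballot u \<Longrightarrow> 1 \<le> a \<Longrightarrow> a < b \<Longrightarrow> count_list u b \<le> count_list u a"
  by (force simp: ballot_def)

lemma ballot_snoc_1:
  "ballot (u @ [1]) \<longleftrightarrow> ballot u"
  by (auto simp: ballot_snoc dest: ballot_count_le intro: le_SucI)

text \<open>Letters above 2 never occur, so the only comparison that can fail is that of 2 with
  1.\<close>

lemma ballot_snoc_2: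
  assumes "set u \<subseteq> {1, 2}"
  shows "ballot (u @ [2]) \<longleftrightarrow> ballot u \<and> count_list u 2 + 1 \<le> count_list u 1"
proof -
  have zero: "count_list u b = 0" if "2 < b" for b
    using assms that by (auto simp: count_list_0_iff)
  show ?thesis
  proof
    assume "ballot (u @ [2])"
    then show "ballot u \<and> count_list u 2 + 1 \<le> count_list u 1"
      using ballot_count_le[of "u @ [2]" 1 2] by (simp add: ballot_snoc)
  next
    assume u: "ballot u \<and> count_list u 2 + 1 \<le> count_list u 1"
    have "count_list (u @ [2]) b \<le> count_list (u @ [2]) a" if "1 \<le> a" "a < b" for a b
    proof (cases "b = 2")
      case True
      with that have "a = 1" by simp
      with True u show ?thesis by simp
    next
      case False
      with that zero[of b] show ?thesis by (cases "b < 2") auto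
    qed
    with u show "ballot (u @ [2])" by (simp add: ballot_snoc)
  qed
qed

text \<open>Each further 2 lowers the excess of 1s, so the end of the block is the critical prefix.
  For \<open>k = 0\<close> the inequality already follows from \<open>ballot u\<close>.\<close>

lemma ballot_append_2s:
  assumes "set u \<subseteq> {1, 2}"
  shows "ballot (u @ replicate k 2) \<longleftrightarrow> ballot u \<and> count_list u 2 + k \<le> count_list u 1"
proof (induction k)
  case (Suc k)
  have "ballot (u @ replicate (Suc k) 2) \<longleftrightarrow> ballot ((u @ replicate k 2) @ [2])"
    by (simp add: replicate_append_same)
  also have "\<dots> \<longleftrightarrow> ballot (u @ replicate k 2) \<and> count_list u 2 + Suc k \<le> count_list u 1"
    by (subst ballot_snoc_2) (use assms in \<open>auto simp: count_list_replicate\<close>)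
  finally show ?case using Suc.IH by auto
qed (auto dest: ballot_count_le[of u 1 2])

lemma ballot_append_1s: "ballot (u @ replicate l 1) \<longleftrightarrow> ballot u"
proof (induction l)
  case (Suc l)
  then show ?case
    using ballot_snoc_1[of "u @ replicate l 1"] by (simp add: replicate_append_same)
qed simp

definition two_letter_word :: "nat \<Rightarrow> nat list \<Rightarrow> nat list" where
  "two_letter_word s ks = concat (map (\<lambda>k. replicate k 2 @ replicate (s - k) 1) ks)"

lemma set_two_letter_word: "set (two_letter_word s ks) \<subseteq> {1, 2}"
  by (auto simp: two_letter_word_def)

lemma count_2_two_letter_word: "count_list (two_letter_word s ks) 2 = sum_list ks"
  by (induction ks) (auto simp: two_letter_word_def count_list_replicate)

lemma count_1_two_letter_word:
  "set ks \<subseteq> {..s} \<Longrightarrow> count_list (two_letter_word s ks) 1 + sum_list ks = s * length ks"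
  by (induction ks) (auto simp: two_letter_word_def count_list_replicate)

lemma ballot_two_letter_word:
  "set ks \<subseteq> {..s} \<Longrightarrow> ballot (two_letter_word s ks) \<longleftrightarrow> ballot_steps s ks"
proof (induction ks rule: rev_induct)
  case Nil
  then show ?case by (simp add: two_letter_word_def ballot_def ballot_steps_def)
next
  case (snoc k ks)
  have "two_letter_word s (ks @ [k]) =
      (two_letter_word s ks @ replicate k 2) @ replicate (s - k) 1"
    by (simp add: two_letter_word_def)
  then have "ballot (two_letter_word s (ks @ [k])) \<longleftrightarrow> ballot (two_letter_word s ks) \<and>
      sum_list ks + k \<le> count_list (two_letter_word s ks) 1"
    by (simp only: ballot_append_1s ballot_append_2s[OF set_two_letter_word]
        count_2_two_letter_word)
  then show ?case
    using snoc count_1_two_letter_word[of ks s] by (auto simp: ballot_steps_snoc)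
qed

lemma sorted_two_letters:
  assumes "sorted xs" and "set xs \<subseteq> {1, 2}"
  shows "xs = replicate (count_list xs 1) 1 @ replicate (count_list xs 2) (2::nat)"
  using assms
proof (induction xs)
  case (Cons x xs)
  show ?case
  proof (cases "x = 1")
    case False
    with Cons.prems have "x = 2" "1 \<notin> set xs" by auto
    with Cons show ?thesis by (simp add: count_list_0_iff)
  qed (use Cons in simp)
qed simp

section \<open>Tableaux of difference-of-staircases shape\<close>

lemma part_stretch: "part (stretch s lam) i = s * part lam i"
  by (simp add: part_def stretch_def)

lemma part_staircase: "part (staircase m) i = m - i"
  by (auto simp: part_def staircase_def rev_nth simp del: upt_Suc)

lemma length_stretch_staircase: "length (stretch s (staircase m)) = m"
  by (simp add: stretch_def staircase_def)

lemma count_list_map_upt: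
  "count_list (map f [a..<b]) v = card {j \<in> {a..<b}. f j = v}"
proof (induction b)
  case (Suc b)
  show ?case
  proof (cases "a \<le> b")
    case True
    then have "{j \<in> {a..<Suc b}. f j = v} =
        (if f b = v then insert b {j \<in> {a..<b}. f j = v} else {j \<in> {a..<b}. f j = v})"
      by (auto simp: less_Suc_eq)
    then show ?thesis using True Suc by simp
  qed auto
qed auto

text \<open>The reading word visits each cell exactly once, rows beyond \<open>length lam\<close>
  being empty. This turns the content condition into letter counts.\<close>

lemma count_list_reading_word:
  "count_list (reading_word lam \<mu> T) v = card {c \<in> skew_shape lam \<mu>. T c = v}"
proof -
  let ?R = "\<lambda>i. {j \<in> {part \<mu> i..<part lam i}. T (i, j) = v}"
  have "{c \<in> skew_shape lam \<mu>. T c = v} = (SIGMA i:{..<length lam}. ?R i)"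
    by (auto simp: skew_shape_def part_def split: if_splits)
  then have "card {c \<in> skew_shape lam \<mu>. T c = v} = (\<Sum>i<length lam. card (?R i))"
    by simp
  also have "\<dots> = count_list (reading_word lam \<mu> T) v"
    by (simp add: reading_word_def count_list_concat comp_def rev_map[symmetric]
        count_list_map_upt interv_sum_list_conv_sum_set_nat atLeast0LessThan)
  finally show ?thesis by simp
qed

text \<open>Row \<open>i\<close> from left to right, hence the reverse of its segment in the reading
  word.\<close>

definition row_word :: "nat \<Rightarrow> nat \<Rightarrow> (nat \<times> nat \<Rightarrow> nat) \<Rightarrow> nat \<Rightarrow> nat list" where
  "row_word s m T i = map (\<lambda>j. T (i, j)) [s * (m - 1 - i)..<s * (m - i)]"

text \<open>The last \<open>ks ! i\<close> cells of row \<open>i\<close> receive 2. For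
  \<open>i \<ge> m\<close> the column interval is empty, so no index outside a list of length
  \<open>m\<close> affects the value.\<close>

definition filling :: "nat \<Rightarrow> nat \<Rightarrow> nat list \<Rightarrow> nat \<times> nat \<Rightarrow> nat" where
  "filling s m ks = (\<lambda>(i, j).
     if s * (m - 1 - i) \<le> j \<and> j < s * (m - i)
     then if j + ks ! i < s * (m - i) then 1 else 2 else 0)"

section \<open>The strip between consecutive stretched staircases\<close>

context
  fixes s m :: nat and lam \<mu> :: "nat list"
  defines "lam \<equiv> stretch s (staircase m)" and "\<mu> \<equiv> stretch s (staircase (m - 1))"
begin

lemma mem_strip_iff: "(i, j) \<in> skew_shape lam \<mu> \<longleftrightarrow> s * (m - 1 - i) \<le> j \<and> j < s * (m - i)"
  by (simp add: lam_def \<mu>_def skew_shape_def part_stretch part_staircase)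

lemma mem_strip_row_less: "(i, j) \<in> skew_shape lam \<mu> \<Longrightarrow> i < m"
  by (rule ccontr) (simp add: mem_strip_iff)

text \<open>A lower row stops no further right than the column where a higher row starts, because
  \<open>i < i'\<close> gives \<open>m - i' \<le> m - 1 - i\<close>.\<close>

lemma strip_rows_column_disjoint:
  assumes "(i, j) \<in> skew_shape lam \<mu>" and "(i', j) \<in> skew_shape lam \<mu>"
  shows "\<not> i < i'"
proof
  assume "i < i'"
  then have "s * (m - i') \<le> s * (m - 1 - i)" by (intro mult_le_mono2) auto
  moreover have "s * (m - 1 - i) \<le> j" "j < s * (m - i')"
    using assms by (simp_all add: mem_strip_iff)
  ultimately show False by linarith
qed

lemma reading_word_strip:
  "reading_word lam \<mu> T = concat (map (\<lambda>i. rev (row_word s m T i)) [0..<m])"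
  unfolding reading_word_def row_word_def
  by (simp add: lam_def \<mu>_def part_stretch part_staircase length_stretch_staircase rev_map)

lemma row_end:
  assumes "i < m"
  shows "s * (m - i) = s * (m - 1 - i) + s"
proof -
  have "m - i = Suc (m - 1 - i)" using assms by simp
  then show ?thesis by simp
qed

lemma length_row_word: "i < m \<Longrightarrow> length (row_word s m T i) = s"
  by (simp add: row_word_def row_end)

lemma row_word_filling:
  assumes "i < m" and "ks ! i \<le> s"
  shows "row_word s m (filling s m ks) i = replicate (s - ks ! i) 1 @ replicate (ks ! i) 2"
  using assms
  by (intro nth_equalityI)
     (auto simp: row_word_def filling_def row_end nth_append simp del: upt_Suc)

lemma reading_word_filling:
  assumes "length ks = m" and "set ks \<subseteq> {..s}"
  shows "reading_word lam \<mu> (filling s m ks) = two_letter_word s ks"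
proof -
  have "rev (row_word s m (filling s m ks) i) =
      replicate (ks ! i) 2 @ replicate (s - ks ! i) 1" if "i < m" for i
    using that assms by (subst row_word_filling) (auto simp: subset_iff)
  then have "map (\<lambda>i. rev (row_word s m (filling s m ks) i)) [0..<m] =
      map (\<lambda>k. replicate k 2 @ replicate (s - k) 1) ks"
    using assms(1) by (intro nth_equalityI) auto
  then show ?thesis
    by (simp add: reading_word_strip two_letter_word_def)
qed

section \<open>The bijection between ballot sequences and tableaux\<close>

lemma inj_on_filling:
  "inj_on (filling s m) {ks. length ks = m \<and> set ks \<subseteq> {..s}}"
proof (rule inj_onI)
  fix ks ks'
  assume "ks \<in> {ks. length ks = m \<and> set ks \<subseteq> {..s}}"
    and "ks' \<in> {ks. length ks = m \<and> set ks \<subseteq> {..s}}"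
    and eq: "filling s m ks = filling s m ks'"
  then have ks: "length ks = m" "set ks \<subseteq> {..s}" and ks': "length ks' = m" "set ks' \<subseteq> {..s}"
    by auto
  show "ks = ks'"
  proof (rule nth_equalityI)
    fix i assume i: "i < length ks"
    then have le: "i < m" "ks ! i \<le> s" "ks' ! i \<le> s"
      using ks ks' by (auto simp: subset_iff)
    from row_word_filling[OF le(1,2)] row_word_filling[OF le(1,3)]
    have "replicate (s - ks ! i) 1 @ replicate (ks ! i) (2::nat) =
        replicate (s - ks' ! i) 1 @ replicate (ks' ! i) 2"
      by (simp add: eq)
    \<comment> \<open>The number of 2s in row \<open>i\<close> recovers
      \<open>ks ! i\<close>.\<close>
    from arg_cong[OF this, of "\<lambda>w. count_list w 2"] show "ks ! i = ks' ! i"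
      by (simp add: count_list_replicate)
  qed (use ks ks' in simp)
qed

lemma semistandard_filling: "semistandard (skew_shape lam \<mu>) (filling s m ks)"
  unfolding semistandard_def
proof (intro conjI allI impI)
  show "\<forall>c\<in>skew_shape lam \<mu>. 1 \<le> filling s m ks c"
    by (auto simp: mem_strip_iff filling_def)
next
  fix i j j' assume "(i, j) \<in> skew_shape lam \<mu> \<and> (i, j') \<in> skew_shape lam \<mu> \<and> j < j'"
  then show "filling s m ks (i, j) \<le> filling s m ks (i, j')"
    by (auto simp: mem_strip_iff filling_def)
next
  fix i i' j assume "(i, j) \<in> skew_shape lam \<mu> \<and> (i', j) \<in> skew_shape lam \<mu> \<and> i < i'"
  then show "filling s m ks (i, j) < filling s m ks (i', j)"
    using strip_rows_column_disjoint by blast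
qed

text \<open>Surjectivity of \<open>filling\<close>: a weakly increasing row in the letters 1 and 2
  is determined by its number of 2s, which serves as the entry of \<open>ks\<close>.\<close>

lemma filling_of_two_letter_rows:
  assumes zero: "\<And>c. c \<notin> skew_shape lam \<mu> \<Longrightarrow> T c = 0"
    and semi: "semistandard (skew_shape lam \<mu>) T"
    and letters: "\<And>c. c \<in> skew_shape lam \<mu> \<Longrightarrow> T c \<in> {1, 2}"
  obtains ks where "length ks = m" and "set ks \<subseteq> {..s}" and "T = filling s m ks"
proof
  define ks where "ks = map (\<lambda>i. count_list (row_word s m T i) 2) [0..<m]"
  show "length ks = m" by (simp add: ks_def)
  have nth: "ks ! i = count_list (row_word s m T i) 2" if "i < m" for i
    using that by (simp add: ks_def)
  have le: "count_list (row_word s m T i) 2 \<le> s" if "i < m" for i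
    using count_le_length[of "row_word s m T i" 2] length_row_word[OF that] by simp
  then show "set ks \<subseteq> {..s}" by (auto simp: ks_def)
  have row: "row_word s m T i = row_word s m (filling s m ks) i" if i: "i < m" for i
  proof -
    let ?w = "row_word s m T i"
    have "T (i, j) \<le> T (i, j')"
      if "s * (m - 1 - i) \<le> j" "j < j'" "j' < s * (m - i)" for j j'
    proof -
      have "(i, j) \<in> skew_shape lam \<mu>" "(i, j') \<in> skew_shape lam \<mu>"
        using that by (simp_all add: mem_strip_iff)
      then show ?thesis using semi that(2) unfolding semistandard_def by blast
    qed
    then have "sorted ?w"
      by (auto simp: row_word_def sorted_iff_nth_mono_less)
    moreover have "set ?w \<subseteq> {1, 2}"
    proof
      fix x assume "x \<in> set ?w"
      then obtain j where "(i, j) \<in> skew_shape lam \<mu>" "x = T (i, j)"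
        by (auto simp: row_word_def mem_strip_iff)
      then show "x \<in> {1, 2}" using letters by simp
    qed
    ultimately have w: "?w = replicate (count_list ?w 1) 1 @ replicate (count_list ?w 2) 2"
      by (rule sorted_two_letters)
    \<comment> \<open>The row length fixes the number of 1s as \<open>s - ks ! i\<close>, matching
      the form of a row of \<open>filling\<close>.\<close>
    then have "s = count_list ?w 1 + count_list ?w 2"
      using length_row_word[OF i, of T] by (metis length_append length_replicate)
    with w show ?thesis
      using row_word_filling[of i ks] nth[OF i] le[OF i] i by (metis add_diff_cancel_right')
  qed
  show "T = filling s m ks"
  proof
    fix c :: "nat \<times> nat"
    obtain i j where c: "c = (i, j)" by force
    show "T c = filling s m ks c"
    proof (cases "c \<in> skew_shape lam \<mu>")
      case True
      then show ?thesis
        using row[of i] mem_strip_row_less[of i j]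
        by (auto simp: c row_word_def mem_strip_iff map_eq_conv)
    next
      case False
      then show ?thesis using zero[of c] by (auto simp: c mem_strip_iff filling_def)
    qed
  qed
qed

text \<open>The strip has \<open>s * m\<close> cells, so once the number of 2s is \<open>b\<close>,
  the hypothesis forces the number of 1s to be \<open>a\<close>.\<close>

lemma LR_tableaux_strip:
  assumes "a + b = s * m"
  shows "LR_tableaux lam \<mu> [a, b] = filling s m ` ballot_seqs s m b"
proof (intro equalityI subsetI)
  fix T assume T: "T \<in> LR_tableaux lam \<mu> [a, b]"
  let ?w = "reading_word lam \<mu> T"
  have content: "count_list ?w (v + 1) = part [a, b] v" for v
    using T by (simp add: LR_tableaux_def has_content_def count_list_reading_word)
  \<comment> \<open>Letter \<open>v + 1\<close> has multiplicity \<open>part [a, b] v\<close>, which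
    takes the default value 0 from \<open>v = 2\<close> on; hence no letter exceeds 2.\<close>
  have letters: "T c \<in> {1, 2}" if c: "c \<in> skew_shape lam \<mu>" for c
  proof (rule ccontr)
    assume "T c \<notin> {1, 2}"
    moreover have "1 \<le> T c"
      using T c by (simp add: LR_tableaux_def semistandard_def)
    ultimately obtain v where v: "T c = v + 1" "2 \<le> v"
      by (cases "T c") auto
    then have "card {c \<in> skew_shape lam \<mu>. T c = v + 1} = 0"
      using content[of v] by (simp add: count_list_reading_word part_def)
    moreover have "finite {c \<in> skew_shape lam \<mu>. T c = v + 1}"
      by (rule finite_subset[OF _ finite_skew_shape]) auto
    ultimately have "{c \<in> skew_shape lam \<mu>. T c = v + 1} = {}"
      by (simp only: card_0_eq)
    then show False using c v(1) by blast
  qed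
  obtain ks where ks: "length ks = m" "set ks \<subseteq> {..s}" "T = filling s m ks"
    using filling_of_two_letter_rows[of T] T letters by (auto simp: LR_tableaux_def)
  then have w: "?w = two_letter_word s ks"
    by (simp add: reading_word_filling)
  have "sum_list ks = b"
    using content[of 1] count_2_two_letter_word[of s ks]
    by (simp add: w part_def numeral_2_eq_2)
  moreover have "ballot_steps s ks"
    using T w ks(2) by (simp add: LR_tableaux_def ballot_two_letter_word)
  ultimately show "T \<in> filling s m ` ballot_seqs s m b"
    using ks by (auto simp: ballot_seqs_def)
next
  fix T assume "T \<in> filling s m ` ballot_seqs s m b"
  then obtain ks where ks: "length ks = m" "set ks \<subseteq> {..s}" "ballot_steps s ks"
    "sum_list ks = b" and T: "T = filling s m ks"
    by (auto simp: ballot_seqs_def)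
  have w: "reading_word lam \<mu> T = two_letter_word s ks"
    using ks by (simp add: T reading_word_filling)
  have "count_list (two_letter_word s ks) (v + 1) = part [a, b] v" for v
  proof -
    consider "v = 0" | "v = 1" | "2 \<le> v" by linarith
    then show ?thesis
    proof cases
      case 1
      then show ?thesis
        using count_1_two_letter_word[OF ks(2)] ks assms by (simp add: part_def)
    next
      case 2
      then show ?thesis
        using count_2_two_letter_word[of s ks] ks by (simp add: part_def numeral_2_eq_2)
    next
      case 3
      then have "v + 1 \<notin> set (two_letter_word s ks)"
        using set_two_letter_word[of s ks] by auto
      then show ?thesis using 3 by (simp add: part_def count_list_0_iff)
    qed
  qed
  then have "has_content (skew_shape lam \<mu>) T [a, b]"
    by (simp add: has_content_def count_list_reading_word[symmetric] w)
  moreover have "part \<mu> i \<le> part lam i" for i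
    by (simp add: lam_def \<mu>_def part_stretch part_staircase diff_le_mono2)
  moreover have "T c = 0" if "c \<notin> skew_shape lam \<mu>" for c
    using that by (cases c) (auto simp: T mem_strip_iff filling_def)
  moreover have "ballot (reading_word lam \<mu> T)"
    using ks by (simp add: w ballot_two_letter_word)
  ultimately show "T \<in> LR_tableaux lam \<mu> [a, b]"
    using semistandard_filling[of ks] by (simp add: LR_tableaux_def T)
qed

lemma LR_coeff_strip:
  assumes "a + b = s * m"
  shows "LR_coeff lam \<mu> [a, b] = card (ballot_seqs s m b)"
  unfolding LR_coeff_def LR_tableaux_strip[OF assms]
  by (rule card_image, rule inj_on_subset[OF inj_on_filling]) (auto simp: ballot_seqs_def)

end

theorem theorem2:
  fixes s n :: nat
  assumes "0 < s" and "0 < n"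
  shows "int (LR_coeff (stretch s (staircase (2 * n)))
                       (stretch s (staircase (2 * n - 1)))
                       (stretch s [n, n])) =
         s_binomial s (2 * n) (s * n) - s_binomial s (2 * n) (s * n + 1)"
proof -
  have "LR_coeff (stretch s (staircase (2 * n))) (stretch s (staircase (2 * n - 1)))
      (stretch s [n, n]) = card (ballot_seqs s (2 * n) (s * n))"
    \<comment> \<open>The content \<open>stretch s [n, n]\<close> is \<open>[s * n, s * n]\<close>,
      whose total is the number \<open>s * (2 * n)\<close> of cells.\<close>
    using LR_coeff_strip[of "s * n" "s * n" s "2 * n"] by (simp add: stretch_def)
  \<comment> \<open>This is the boundary case \<open>2 * t = s * m\<close> of the count.\<close>
  moreover have "int (card (ballot_seqs s (2 * n) (s * n))) =
      sbinom s (2 * n) (int (s * n)) - sbinom s (2 * n) (int (s * n) - 1)"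
    by (rule card_ballot_seqs) simp
  \<comment> \<open>The coefficients are symmetric about the index \<open>s * n\<close>, so its two
    neighbours carry equal values.\<close>
  moreover have "sbinom s (2 * n) (int (s * n) - 1) = sbinom s (2 * n) (int (s * n + 1))"
    using sbinom_symmetric[of s "2 * n" "int (s * n + 1)"] by (simp add: algebra_simps)
  ultimately show ?thesis
    by (simp add: s_binomial_eq_sbinom)
qed

end
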